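(* Consider the state-dependent coefficient system $\dot\xi(t)=A(\xi(t))\,\xi(t)$ with $A\colon\mathbb R^n\to\mathbb R^{n\times n}$ Lipschitz continuous. Let $X\subset\mathbb R^n$ be a bounded set such that every solution $\xi$ of the system with $\xi(0)\in X$ satisfies $\xi(t)\in X$ for all $t\ge 0$ for which it is defined. Let $L\in\mathbb R$, $K>0$, $\omega>0$ be constants such that $$\|A(x_1)-A(x_2)\|\le L\|x_1-x_2\|\quad\text{for all }x_1,x_2\in X,$$ $$\|e^{A(x)s}\|\le K e^{-\omega s}\quad\text{for all }x\in X\text{ and all } s>0.$$ Put $M:=\sup_{x\in X}\|A(x)x\|$. If $$KLM\log 2<\omega^2,$$ then the system $\dot\xi(t)=A(\xi(t))\xi(t)$ is uniformly exponentially stable on $X$.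
   Context: $\|\cdot\|$ denotes a fixed norm on $\mathbb R^n$ and the induced operator norm on $\mathbb R^{n\times n}$; $\log$ is the natural logarithm. Definition: for $X\subset\mathbb R^n$, the system $\dot\xi(t)=A(\xi(t))\xi(t)$ is called uniformly exponentially stable on $X$ if there exist positive constants $K'$ and $\omega'$ such that for any $x_0\in X$, a solution $\xi$ of the system with $\xi(0)=x_0$ satisfies $\|\xi(t)\|\le K' e^{-\omega' t}\|x_0\|$ for $t\ge 0$. *)

theory Defs
  imports "HOL-Analysis.Analysis"
begin

text \<open>An arbitrary norm on $\mathbb{R}^n$; the type-class norm of \<^typ>\<open>real ^ 'n\<close> is only the
  Euclidean one.\<close>

definition is_norm :: "(real ^ 'n \<Rightarrow> real) \<Rightarrow> bool" where
  "is_norm N \<longleftrightarrow>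
     (\<forall>x. 0 \<le> N x) \<and>
     (\<forall>x. N x = 0 \<longleftrightarrow> x = 0) \<and>
     (\<forall>c x. N (c *\<^sub>R x) = \<bar>c\<bar> * N x) \<and>
     (\<forall>x y. N (x + y) \<le> N x + N y)"

text \<open>As in \<^const>\<open>onorm\<close>, the point \<open>x = 0\<close> contributes \<open>0 / 0 = 0\<close>.\<close>

definition op_norm :: "(real ^ 'n \<Rightarrow> real) \<Rightarrow> real ^ 'n ^ 'n \<Rightarrow> real" where
  "op_norm N B = (SUP x. N (B *v x) / N x)"

text \<open>The library product \<open>*\<close> on \<^typ>\<open>real ^ 'n ^ 'n\<close> is componentwise, so the powers are
  spelled out with \<open>**\<close>.\<close>

definition mat_exp :: "real ^ 'n ^ 'n \<Rightarrow> real ^ 'n ^ 'n" where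
  "mat_exp B = (\<Sum>k. (1 / fact k) *\<^sub>R (((**) B) ^^ k) (mat 1))"

text \<open>\<open>\<xi>\<close> solves $\dot\xi(t) = A(\xi(t))\,\xi(t)$ on the interval \<open>J\<close>, which contains the initial
  time and need not be maximal; derivatives at end points belonging to \<open>J\<close> are one-sided.\<close>

definition sdc_solution ::
  "(real ^ 'n \<Rightarrow> real ^ 'n ^ 'n) \<Rightarrow> real set \<Rightarrow> (real \<Rightarrow> real ^ 'n) \<Rightarrow> bool" where
  "sdc_solution A J \<xi> \<longleftrightarrow>
     is_interval J \<and> 0 \<in> J \<and>
     (\<forall>t\<in>J. (\<xi> has_vector_derivative A (\<xi> t) *v \<xi> t) (at t within J))"

text \<open>From every initial value in \<open>X\<close> there is a solution on \<open>[0, \<infinity>)\<close>, and every solution obeys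
  the exponential bound at all nonnegative times of its domain.\<close>

definition uniformly_exponentially_stable_on ::
  "(real ^ 'n \<Rightarrow> real) \<Rightarrow> (real ^ 'n \<Rightarrow> real ^ 'n ^ 'n) \<Rightarrow> (real ^ 'n) set \<Rightarrow> bool" where
  "uniformly_exponentially_stable_on N A X \<longleftrightarrow>
     (\<exists>K'>0. \<exists>\<omega>'>0. \<forall>x0\<in>X.
        (\<exists>\<xi>. sdc_solution A {0..} \<xi> \<and> \<xi> 0 = x0) \<and>
        (\<forall>J \<xi>. sdc_solution A J \<xi> \<and> \<xi> 0 = x0 \<longrightarrow>
           (\<forall>t\<in>J. 0 \<le> t \<longrightarrow> N (\<xi> t) \<le> K' * exp (- \<omega>' * t) * N x0)))"

end

theory Submission imports Defs begin

text \<open>Along a solution \<open>\<xi>\<close> the matrix \<open>A (\<xi> t)\<close> is Lipschitz in \<open>t\<close> with constant \<open>a = L * M\<close>.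
  Fix \<open>t\<close> and apply variation of constants to the system frozen at time \<open>\<tau>\<close>:
  with \<open>y s = exp (\<omega> * s) * N (\<xi> s)\<close> one gets
  \<open>y t \<le> K * y 0 + K * a * integral {0..t} (\<lambda>s. \<bar>s - \<tau>\<bar> * y s)\<close>.
  If \<open>y s\<close> grows at most like \<open>exp (\<mu> * s)\<close>, the best lag \<open>t - \<tau>\<close> is the median \<open>ln 2 / \<mu>\<close> of the
  exponential distribution with rate \<open>\<mu>\<close>, whose mean absolute deviation from the median is also
  \<open>ln 2 / \<mu>\<close>; the integral term is then at most \<open>K * a * ln 2 / \<mu>\<^sup>2\<close> times the bound on \<open>y t\<close>, and
  can be absorbed as soon as \<open>K * a * ln 2 < \<mu>\<^sup>2\<close>.  The hypothesis leaves room for such a \<open>\<mu> < \<omega>\<close>.\<close>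

subsection \<open>Norms on $\mathbb{R}^n$\<close>

lemma is_normD:
  assumes "is_norm N"
  shows "0 \<le> N x" "N x = 0 \<longleftrightarrow> x = 0" "N (c *\<^sub>R x) = \<bar>c\<bar> * N x" "N (x + y) \<le> N x + N y"
    "N 0 = 0"
  using assms unfolding is_norm_def by blast+

text \<open>Homogeneity and the triangle inequality make \<open>N\<close> convex, and a finite
  convex function on a finite-dimensional space is continuous.\<close>

lemma is_norm_continuous_on:
  assumes "is_norm N"
  shows "continuous_on S N"
proof -
  have "convex_on UNIV N"
  proof (rule convex_onI)
    fix t x y assume t: "0 < (t::real)" "t < 1"
    have "N ((1 - t) *\<^sub>R x + t *\<^sub>R y) \<le> N ((1 - t) *\<^sub>R x) + N (t *\<^sub>R y)"
      by (rule is_normD(4)[OF assms])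
    then show "N ((1 - t) *\<^sub>R x + t *\<^sub>R y) \<le> (1 - t) * N x + t * N y"
      using t by (simp add: is_normD(3)[OF assms])
  qed simp
  then have "continuous_on UNIV N"
    by (intro convex_on_continuous) auto
  then show ?thesis
    by (rule continuous_on_subset) simp
qed

text \<open>The constants are the extreme values of \<open>N\<close> on the compact Euclidean unit
  sphere; homogeneity carries the bounds to all vectors.\<close>

lemma is_norm_equivalent:
  assumes "is_norm N"
  obtains c C where "c > 0" "C > 0" "\<And>x. c * norm x \<le> N x" "\<And>x. N x \<le> C * norm x"
proof -
  let ?S = "sphere (0::real^'a) 1"
  have ne: "?S \<noteq> {}" by simp
  obtain a where a: "a \<in> ?S" "\<And>x. x \<in> ?S \<Longrightarrow> N a \<le> N x"
    using continuous_attains_inf[OF compact_sphere ne is_norm_continuous_on[OF assms]] by blast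
  obtain b where b: "b \<in> ?S" "\<And>x. x \<in> ?S \<Longrightarrow> N x \<le> N b"
    using continuous_attains_sup[OF compact_sphere ne is_norm_continuous_on[OF assms]] by blast
  have pos: "N x > 0" if "x \<in> ?S" for x
    using that is_normD(1,2)[OF assms, of x] by fastforce
  have scale: "N x = norm x * N (x /\<^sub>R norm x)" for x
    by (cases "x = 0") (simp_all add: is_normD(2,3)[OF assms])
  have bounds: "N a * norm x \<le> N x \<and> N x \<le> N b * norm x" for x
  proof (cases "x = 0")
    case False
    then have "x /\<^sub>R norm x \<in> ?S" by simp
    then have "norm x * N a \<le> norm x * N (x /\<^sub>R norm x)" "norm x * N (x /\<^sub>R norm x) \<le> norm x * N b"
      using a b by (auto intro!: mult_left_mono)
    then show ?thesis
      unfolding scale[of x, symmetric] by (simp add: mult.commute)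
  qed (simp add: is_normD(5)[OF assms])
  show thesis
    by (rule that[of "N a" "N b"]) (use pos a(1) b(1) bounds in auto)
qed

text \<open>A real supremum is informative only for a bounded family. Passing to the Euclidean norm
  and back bounds the quotients by \<open>C * b / c\<close>.\<close>

lemma op_norm:
  assumes "is_norm N"
  shows "N (B *v x) \<le> op_norm N B * N x" and "0 \<le> op_norm N B"
proof -
  obtain c C where cC: "c > 0" "C > 0" "\<And>x. c * norm x \<le> N x" "\<And>x. N x \<le> C * norm x"
    using is_norm_equivalent[OF assms] by blast
  obtain b where b: "b > 0" "\<And>x. norm (B *v x) \<le> b * norm x"
    using linear_bounded_pos[OF matrix_vector_mul_linear[of B]] by blast
  have "N (B *v y) / N y \<le> C * b / c" for y
  proof (cases "y = 0")
    case False
    then have pos: "N y > 0" using is_normD(1,2)[OF assms, of y] by linarith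
    have "N (B *v y) \<le> C * (b * norm y)"
      using cC(4)[of "B *v y"] b(2)[of y] cC(2) by (meson mult_left_mono less_imp_le order_trans)
    also have "\<dots> = C * b / c * (c * norm y)" using cC by simp
    also have "\<dots> \<le> C * b / c * N y" using cC b by (intro mult_left_mono) auto
    finally show ?thesis using pos by (simp add: divide_le_eq)
  qed (use cC b is_normD(5)[OF assms] in simp)
  then have bdd: "bdd_above (range (\<lambda>y. N (B *v y) / N y))"
    by (meson bdd_aboveI2)
  have le: "N (B *v y) / N y \<le> op_norm N B" for y
    unfolding op_norm_def by (rule cSUP_upper[OF _ bdd]) simp
  show "0 \<le> op_norm N B"
    using le[of 0] is_normD(5)[OF assms] by simp
  show "N (B *v x) \<le> op_norm N B * N x"
  proof (cases "x = 0")
    case False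
    then have "N x > 0" using is_normD(1,2)[OF assms, of x] by linarith
    then show ?thesis using le[of x] by (simp add: divide_le_eq)
  qed (use is_normD(5)[OF assms] in simp)
qed

text \<open>Finite-dimensional Hahn-Banach: a hyperplane separates \<open>z\<close> from the ball of
  radius \<open>N z\<close>, and its normal is rescaled. Testing against \<phi> turns estimates in
  \<open>N\<close> into estimates for scalar functions.\<close>

lemma is_norm_support_functional:
  assumes "is_norm N"
  obtains \<phi> where "\<phi> \<bullet> z = N z" "\<And>x. \<phi> \<bullet> x \<le> N x"
proof (cases "z = 0")
  case True
  then show thesis
    using that[of 0] is_normD(1,5)[OF assms] by simp
next
  case False
  then have Nz: "N z > 0" using is_normD(1,2)[OF assms, of z] by linarith
  define S where "S = {x. N x < N z}"
  have "convex S"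
    unfolding convex_alt S_def
  proof clarify
    fix x y and u :: real assume *: "N x < N z" "N y < N z" "0 \<le> u" "u \<le> 1"
    have "N ((1 - u) *\<^sub>R x + u *\<^sub>R y) \<le> (1 - u) * N x + u * N y"
      using is_normD(4)[OF assms, of "(1 - u) *\<^sub>R x" "u *\<^sub>R y"] * by (simp add: is_normD(3)[OF assms])
    also have "\<dots> < N z" using * by (intro convex_bound_lt) auto
    finally show "N ((1 - u) *\<^sub>R x + u *\<^sub>R y) < N z" .
  qed
  moreover have "0 \<in> S" using Nz is_normD(5)[OF assms] by (simp add: S_def)
  ultimately obtain a b where a: "a \<noteq> 0" "\<And>x. x \<in> S \<Longrightarrow> a \<bullet> x \<le> b" "b \<le> a \<bullet> z"
    using separating_hyperplane_sets[of S "{z}"] unfolding S_def by auto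
  \<comment> \<open>Rescaled to norm \<open>r * N z\<close>, the vector \<open>x\<close> lies in
    \<open>S\<close> for every \<open>r < 1\<close>; then \<open>r\<close> tends to 1.\<close>
  have le_b: "a \<bullet> x * N z \<le> b * N x" if "x \<noteq> 0" for x
  proof -
    have Nx: "N x > 0" using that is_normD(1,2)[OF assms, of x] by linarith
    have "r * (a \<bullet> x * N z) \<le> b * N x" if "0 < r" "r < 1" for r
    proof -
      have "N ((r * N z / N x) *\<^sub>R x) < N z"
        using that Nx Nz by (simp add: is_normD(3)[OF assms])
      then have "(r * N z / N x) *\<^sub>R x \<in> S" by (simp add: S_def)
      from a(2)[OF this] have "r * (a \<bullet> x * N z) / N x \<le> b" by (simp add: ac_simps)
      then show ?thesis using Nx by (simp add: pos_divide_le_eq)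
    qed
    then show ?thesis
      by (rule field_le_mult_one_interval)
  qed
  \<comment> \<open>Separation alone allows \<open>b = 0\<close>; testing \<open>le_b\<close> on the
    normal \<open>a\<close> itself excludes this.\<close>
  have "0 < a \<bullet> a * N z" using a(1) Nz by simp
  then have "0 < b * N a" using le_b[OF a(1)] by linarith
  then have "b > 0"
    using is_normD(1)[OF assms, of a] by (simp add: zero_less_mult_iff)
  then have az: "a \<bullet> z > 0" using a(3) by linarith
  show thesis
  proof
    show "(N z / (a \<bullet> z)) *\<^sub>R a \<bullet> z = N z" using az by simp
    show "(N z / (a \<bullet> z)) *\<^sub>R a \<bullet> x \<le> N x" for x
    proof (cases "x = 0")
      case False
      have "a \<bullet> x * N z \<le> b * N x" by (rule le_b[OF False])
      also have "\<dots> \<le> (a \<bullet> z) * N x" using a(3) is_normD(1)[OF assms] by (rule mult_right_mono)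
      finally show ?thesis using az by (simp add: pos_divide_le_eq ac_simps)
    qed (simp add: is_normD(1)[OF assms])
  qed
qed

subsection \<open>The matrix exponential\<close>

lemma bounded_bilinear_matrix_vector_mult:
  "bounded_bilinear ((*v) :: real^'n^'m \<Rightarrow> real^'n \<Rightarrow> real^'m)"
  unfolding bilinear_conv_bounded_bilinear[symmetric] bilinear_def
  by (auto intro!: linearI simp: algebra_simps scaleR_matrix_vector_assoc)

lemma linear_matrix_matrix_mult:
  "linear ((**) (B :: real^'n^'m) :: real^'k^'n \<Rightarrow> real^'k^'m)"
  "linear (\<lambda>C :: real^'n^'m. C ** (D :: real^'k^'n))"
  by (auto intro!: linearI simp: matrix_matrix_mult_def vec_eq_iff sum.distrib algebra_simps sum_distrib_left)

text \<open>Left multiplication by \<open>B\<close> is a bounded operator with some bound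
  \<open>b\<close>, so the exponential series of \<open>\<bar>s\<bar> * b\<close> dominates
  termwise.\<close>

lemma summable_mat_exp:
  fixes B :: "real^'n^'n"
  shows "summable (\<lambda>k. norm ((s ^ k / fact k) *\<^sub>R (((**) B ^^ k) (mat 1))))"
proof -
  obtain b where b: "b > 0" "\<And>C :: real^'n^'n. norm (B ** C) \<le> b * norm C"
    using linear_bounded_pos[OF linear_matrix_matrix_mult(1)] by blast
  have pow: "norm (((**) B ^^ k) (mat 1)) \<le> b ^ k * norm (mat 1 :: real^'n^'n)" for k
  proof (induction k)
    case (Suc k)
    have "norm (((**) B ^^ Suc k) (mat 1)) \<le> b * norm (((**) B ^^ k) (mat 1))"
      using b(2) by simp
    also have "\<dots> \<le> b * (b ^ k * norm (mat 1 :: real^'n^'n))"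
      using b(1) Suc by simp
    finally show ?case by simp
  qed simp
  have "summable (\<lambda>k. (inverse (fact k) * (\<bar>s\<bar> * b) ^ k) * norm (mat 1 :: real^'n^'n))"
    by (intro summable_mult2 summable_exp)
  then show ?thesis
  proof (rule summable_comparison_test'[where N = 0])
    fix k
    have "norm (norm ((s ^ k / fact k) *\<^sub>R (((**) B ^^ k) (mat 1))))
        = \<bar>s\<bar> ^ k / fact k * norm (((**) B ^^ k) (mat 1))"
      by (simp add: power_abs)
    also have "\<dots> \<le> \<bar>s\<bar> ^ k / fact k * (b ^ k * norm (mat 1 :: real^'n^'n))"
      by (intro mult_left_mono pow) simp
    also have "\<dots> = inverse (fact k) * (\<bar>s\<bar> * b) ^ k * norm (mat 1 :: real^'n^'n)"
      by (simp add: power_mult_distrib divide_inverse)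
    finally show "norm (norm ((s ^ k / fact k) *\<^sub>R (((**) B ^^ k) (mat 1))))
        \<le> inverse (fact k) * (\<bar>s\<bar> * b) ^ k * norm (mat 1 :: real^'n^'n)" .
  qed
qed

lemma mat_exp_scaleR:
  "mat_exp (s *\<^sub>R B) = (\<Sum>k. (s ^ k / fact k) *\<^sub>R (((**) B ^^ k) (mat 1)))"
proof -
  have "((**) (s *\<^sub>R B) ^^ k) (mat 1) = s ^ k *\<^sub>R (((**) B ^^ k) (mat 1))" for k
    by (induction k)
       (simp_all add: linear_scale[OF linear_matrix_matrix_mult(1)] linear_scale[OF linear_matrix_matrix_mult(2)])
  then show ?thesis unfolding mat_exp_def by simp
qed

lemma mat_exp_0: "mat_exp (0 *\<^sub>R B) = mat 1"
proof -
  have "(\<lambda>k. (0 ^ k / fact k) *\<^sub>R (((**) B ^^ k) (mat 1))) = (\<lambda>k. if k = 0 then mat 1 else 0)"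
    by (auto simp: fun_eq_iff power_0_left)
  then show ?thesis
    unfolding mat_exp_scaleR using suminf_finite[of "{0}" "\<lambda>k. if k = 0 then mat 1 else (0 :: real^'a^'a)"]
    by simp
qed

text \<open>Each linear functional of the series is an everywhere convergent real power series in
  \<open>s\<close>, which may be differentiated termwise; the coordinates are then
  reassembled.\<close>

lemma has_vector_derivative_mat_exp:
  fixes B :: "real^'n^'n"
  shows "((\<lambda>s. mat_exp (s *\<^sub>R B)) has_vector_derivative mat_exp (s *\<^sub>R B) ** B) (at s within S)"
proof -
  define P :: "nat \<Rightarrow> real^'n^'n" where "P k = ((**) B ^^ k) (mat 1)" for k
  \<comment> \<open>\<open>B\<close> commutes with its powers. The factor is wanted on the right,
    where it meets the vector first.\<close>
  have P_Suc: "P (Suc k) = P k ** B" for k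
  proof (induction k)
    case (Suc k)
    have "P (Suc (Suc k)) = B ** (P k ** B)" unfolding Suc[symmetric] by (simp add: P_def)
    then show ?case by (simp add: P_def matrix_mul_assoc)
  qed (simp add: P_def)
  have summable: "summable (\<lambda>k. (r ^ k / fact k) *\<^sub>R P k)" for r
    unfolding P_def by (rule summable_norm_cancel[OF summable_mat_exp])
  have entry: "((\<lambda>r. f (mat_exp (r *\<^sub>R B))) has_real_derivative f (mat_exp (s *\<^sub>R B) ** B)) (at s)"
    if f: "bounded_linear f" for f :: "real^'n^'n \<Rightarrow> real"
  proof -
    have f_scale: "f (r *\<^sub>R M) = r * f M" for r M
      using linear_scale[OF bounded_linear.linear[OF f], of r M] by simp
    define c where "c k = f (P k) / fact k" for k
    have suminf: "f (mat_exp (r *\<^sub>R B)) = (\<Sum>k. c k * r ^ k)" for r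
      unfolding mat_exp_scaleR P_def[symmetric] c_def bounded_linear.suminf[OF f summable]
      by (simp add: f_scale ac_simps)
    have "summable (\<lambda>k. c k * r ^ k)" for r
      using bounded_linear.summable[OF f summable[of r]] unfolding c_def
      by (simp add: f_scale ac_simps)
    from termdiffs_strong_converges_everywhere[OF this]
    have deriv: "((\<lambda>r. f (mat_exp (r *\<^sub>R B))) has_real_derivative (\<Sum>k. diffs c k * s ^ k)) (at s)"
      unfolding suminf .
    have f_mult: "bounded_linear (\<lambda>C. f (C ** B))"
      using linear_compose[OF linear_matrix_matrix_mult(2) bounded_linear.linear[OF f]]
      unfolding o_def linear_conv_bounded_linear .
    have "f (mat_exp (s *\<^sub>R B) ** B) = (\<Sum>k. f (((s ^ k / fact k) *\<^sub>R P k) ** B))"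
      unfolding mat_exp_scaleR P_def[symmetric] by (rule bounded_linear.suminf[OF f_mult summable])
    also have "\<dots> = (\<Sum>k. diffs c k * s ^ k)"
      by (simp add: diffs_def c_def P_Suc linear_scale[OF linear_matrix_matrix_mult(2)]
          f_scale ac_simps del: of_nat_Suc)
    finally show ?thesis using deriv by simp
  qed
  have "((\<lambda>r. mat_exp (r *\<^sub>R B)) has_vector_derivative mat_exp (s *\<^sub>R B) ** B) (at s)"
    unfolding has_vector_derivative_def
    by (subst has_derivative_componentwise_within)
       (use entry[OF bounded_linear_inner_left, unfolded has_real_derivative_iff_has_vector_derivative
           has_vector_derivative_def] in simp)
  then show ?thesis by (rule has_vector_derivative_at_within)
qed

subsection \<open>Slowly varying linear systems\<close>

text \<open>Replaces integration of an inequality: the bound on the derivative is compared with an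
  explicit antiderivative. Only interior points need derivatives, since those at the end points are
  one-sided.\<close>

lemma DERIV_le_imp_diff_le:
  fixes f g :: "real \<Rightarrow> real"
  assumes "a \<le> b" "continuous_on {a..b} f" "continuous_on {a..b} g"
    and "\<And>x. a < x \<Longrightarrow> x < b \<Longrightarrow>
      \<exists>f' g'. (f has_real_derivative f') (at x) \<and> (g has_real_derivative g') (at x) \<and> f' \<le> g'"
  shows "f b - f a \<le> g b - g a"
proof -
  have "g a - f a \<le> g b - f b"
  proof (rule DERIV_nonneg_imp_increasing_open[OF assms(1)])
    fix x assume "a < x" "x < b"
    from assms(4)[OF this] show "\<exists>y. ((\<lambda>x. g x - f x) has_real_derivative y) (at x) \<and> 0 \<le> y"
      by (metis DERIV_diff diff_ge_0_iff_ge)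
  qed (intro continuous_intros assms)
  then show ?thesis by simp
qed

text \<open>The functional supporting \<open>N\<close> at the increment reduces the claim to the
  scalar mean value inequality.\<close>

lemma is_norm_mvt:
  assumes N: "is_norm N" and "a \<le> b"
    and x: "\<And>t. t \<in> {a..b} \<Longrightarrow> (x has_vector_derivative x' t) (at t within {a..b})"
    and le: "\<And>t. t \<in> {a..b} \<Longrightarrow> N (x' t) \<le> M"
  shows "N (x b - x a) \<le> M * (b - a)"
proof -
  obtain \<phi> where \<phi>: "\<phi> \<bullet> (x b - x a) = N (x b - x a)" "\<And>y. \<phi> \<bullet> y \<le> N y"
    using is_norm_support_functional[OF N] by blast
  have "\<phi> \<bullet> x b - \<phi> \<bullet> x a \<le> M * b - M * a"
  proof (rule DERIV_le_imp_diff_le[OF \<open>a \<le> b\<close>])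
    have "continuous_on {a..b} x"
      by (rule continuous_on_vector_derivative[OF x])
    then show "continuous_on {a..b} (\<lambda>t. \<phi> \<bullet> x t)" by (intro continuous_intros)
  next
    fix t assume t: "a < t" "t < b"
    then have "(x has_vector_derivative x' t) (at t)"
      using x[of t] by (simp add: at_within_Icc_at)
    then have "((\<lambda>t. \<phi> \<bullet> x t) has_real_derivative \<phi> \<bullet> x' t) (at t)"
      unfolding has_real_derivative_iff_has_vector_derivative
      by (rule bounded_linear.has_vector_derivative[OF bounded_linear_inner_right])
    moreover have "((\<lambda>t. M * t) has_real_derivative M) (at t)"
      by (auto intro!: derivative_eq_intros)
    moreover have "\<phi> \<bullet> x' t \<le> M"
      using \<phi>(2)[of "x' t"] le[of t] t by simp
    ultimately show "\<exists>f' g'. ((\<lambda>t. \<phi> \<bullet> x t) has_real_derivative f') (at t) \<and>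
        ((\<lambda>t. M * t) has_real_derivative g') (at t) \<and> f' \<le> g'" by blast
  qed (intro continuous_intros)
  then show ?thesis using \<phi>(1) by (simp add: algebra_simps)
qed

text \<open>\<open>exp (- \<mu> * t) * (H t + H 0 - 2 * H \<tau>)\<close> is the integral of
  \<open>\<bar>s - \<tau>\<bar> * exp (\<mu> * (s - t))\<close> over \<open>[0, t]\<close>.\<close>

lemma median_kernel_bound:
  fixes \<mu> t :: real
  assumes "\<mu> > 0" "t \<ge> 0"
  defines "\<tau> \<equiv> max 0 (t - ln 2 / \<mu>)"
  defines "H \<equiv> \<lambda>s. exp (\<mu> * s) * ((s - \<tau>) / \<mu> - 1 / \<mu>\<^sup>2)"
  shows "exp (- \<mu> * t) * (H t + H 0 - 2 * H \<tau>) \<le> ln 2 / \<mu>\<^sup>2"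
proof (cases "t \<le> ln 2 / \<mu>")
  case True
  then have \<tau>: "\<tau> = 0" by (simp add: \<tau>_def)
  have "exp (- \<mu> * t) * (H t + H 0 - 2 * H \<tau>) = t / \<mu> - (1 - exp (- \<mu> * t)) / \<mu>\<^sup>2"
    unfolding H_def \<tau> using assms(1) by (simp add: exp_minus field_simps)
  also have "\<dots> \<le> t / \<mu>" using assms by simp
  also have "\<dots> \<le> (ln 2 / \<mu>) / \<mu>" using True assms(1) by (intro divide_right_mono) auto
  finally show ?thesis by (simp add: power2_eq_square)
next
  case False
  then have \<tau>: "\<tau> = t - ln 2 / \<mu>" "\<tau> \<ge> 0" by (auto simp: \<tau>_def)
  \<comment> \<open>The median property: \<open>exp (\<mu> * \<tau>)\<close> is half of
    \<open>exp (\<mu> * t)\<close>, so \<open>- 2 * H \<tau>\<close> cancels the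
    \<open>1 / \<mu>\<^sup>2\<close> part of \<open>H t\<close>. What remains besides
    \<open>(t - \<tau>) / \<mu>\<close> comes from \<open>H 0\<close> and is negative.\<close>
  have "\<mu> * \<tau> = \<mu> * t - ln 2" using assms(1) by (simp add: \<tau> field_simps)
  then have exp_\<tau>: "exp (\<mu> * \<tau>) = exp (\<mu> * t) / 2" by (simp add: exp_diff)
  have "exp (- \<mu> * t) * (H t + H 0 - 2 * H \<tau>)
      = (t - \<tau>) / \<mu> - exp (- \<mu> * t) * (\<tau> / \<mu> + 1 / \<mu>\<^sup>2)"
    unfolding H_def exp_\<tau> by (simp add: exp_minus field_simps)
  also have "\<dots> \<le> (t - \<tau>) / \<mu>" using assms \<tau>(2) by simp
  also have "\<dots> = ln 2 / \<mu>\<^sup>2" by (simp add: \<tau>(1) power2_eq_square)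
  finally show ?thesis .
qed

lemma slowly_varying_estimate:
  fixes x :: "real \<Rightarrow> real^'n" and B :: "real \<Rightarrow> real^'n^'n"
  assumes N: "is_norm N" and "0 < t" "0 < \<mu>" "0 \<le> K" "0 \<le> a" "0 \<le> m"
    and x: "\<And>s. s \<in> {0..t} \<Longrightarrow> (x has_vector_derivative B s *v x s) (at s within {0..t})"
    and B: "\<And>r s. r \<in> {0..t} \<Longrightarrow> s \<in> {0..t} \<Longrightarrow> op_norm N (B s - B r) \<le> a * \<bar>s - r\<bar>"
    and stab: "\<And>r s. r \<in> {0..t} \<Longrightarrow> s > 0 \<Longrightarrow>
      op_norm N (mat_exp (s *\<^sub>R B r)) \<le> K * exp (- \<omega> * s)"
    and m: "\<And>s. s \<in> {0..t} \<Longrightarrow> N (x s) \<le> m * exp ((\<mu> - \<omega>) * s)"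
  shows "N (x t) \<le> K * exp (- \<omega> * t) * N (x 0) + K * a * ln 2 / \<mu>\<^sup>2 * m * exp ((\<mu> - \<omega>) * t)"
proof -
  define \<tau> where "\<tau> = max 0 (t - ln 2 / \<mu>)"
  define H where "H s = exp (\<mu> * s) * ((s - \<tau>) / \<mu> - 1 / \<mu>\<^sup>2)" for s
  define c where "c = K * a * m * exp (- \<omega> * t)"
  define E where "E s = mat_exp ((t - s) *\<^sub>R B \<tau>)" for s
  have \<tau>: "0 \<le> \<tau>" "\<tau> \<le> t" using \<open>0 < t\<close> \<open>0 < \<mu>\<close> by (auto simp: \<tau>_def)
  have "0 \<le> c" using assms by (simp add: c_def)
  obtain \<phi> where \<phi>: "\<phi> \<bullet> x t = N (x t)" "\<And>y. \<phi> \<bullet> y \<le> N y"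
    using is_norm_support_functional[OF N] by blast
  define g where "g s = \<phi> \<bullet> (E s *v x s)" for s
  define g' where "g' s = \<phi> \<bullet> (E s *v ((B s - B \<tau>) *v x s))" for s
  have g_deriv: "(g has_vector_derivative g' s) (at s within {0..t})" if "s \<in> {0..t}" for s
  proof -
    have "((\<lambda>s. t - s) has_vector_derivative - 1) (at s within {0..t})"
      by (auto intro!: derivative_eq_intros)
    from vector_diff_chain_within[OF this has_vector_derivative_mat_exp]
    have "(E has_vector_derivative - (E s ** B \<tau>)) (at s within {0..t})"
      by (simp add: E_def[abs_def] o_def)
    from bounded_bilinear.has_vector_derivative[OF bounded_bilinear_matrix_vector_mult this x[OF that]]
    have "((\<lambda>s. E s *v x s) has_vector_derivative E s *v ((B s - B \<tau>) *v x s)) (at s within {0..t})"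
      \<comment> \<open>The instance at 0 moves the minus sign of the derivative of \<open>E\<close>
        out of the product; the two terms of the product rule then combine.\<close>
      using matrix_vector_mult_diff_rdistrib[of 0 "E s ** B \<tau>" "x s"]
      by (simp add: algebra_simps matrix_vector_mul_assoc)
    from bounded_linear.has_vector_derivative[OF bounded_linear_inner_right this]
    show ?thesis unfolding g_def g'_def .
  qed
  have g_cont: "continuous_on S g" if "S \<subseteq> {0..t}" for S
    using g_deriv that
    by (meson continuous_on_subset continuous_on_eq_continuous_within has_vector_derivative_continuous)
  have g_DERIV: "(g has_real_derivative g' s) (at s)" if "0 < s" "s < t" for s
    using g_deriv[of s] that
    by (simp add: has_real_derivative_iff_has_vector_derivative at_within_Icc_at)
  \<comment> \<open>The factors \<open>exp (- \<omega> * (t - s))\<close> and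
    \<open>exp ((\<mu> - \<omega>) * s)\<close> multiply to
    \<open>exp (- \<omega> * t) * exp (\<mu> * s)\<close>; all that is independent of
    \<open>s\<close> goes into \<open>c\<close>. The stability bound applies because
    \<open>t - s > 0\<close>.\<close>
  have g'_le: "g' s \<le> c * (\<bar>s - \<tau>\<bar> * exp (\<mu> * s))" if s: "0 < s" "s < t" for s
  proof -
    have "g' s \<le> N (E s *v ((B s - B \<tau>) *v x s))" unfolding g'_def by (rule \<phi>(2))
    also have "\<dots> \<le> op_norm N (E s) * N ((B s - B \<tau>) *v x s)" by (rule op_norm(1)[OF N])
    also have "\<dots> \<le> op_norm N (E s) * (op_norm N (B s - B \<tau>) * N (x s))"
      by (intro mult_left_mono op_norm[OF N])
    also have "\<dots> \<le> (K * exp (- \<omega> * (t - s))) * ((a * \<bar>s - \<tau>\<bar>) * (m * exp ((\<mu> - \<omega>) * s)))"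
      unfolding E_def using s \<tau> assms
      by (intro mult_mono stab B m mult_nonneg_nonneg op_norm(2)[OF N] is_normD(1)[OF N]) auto
    also have "\<dots> = c * (\<bar>s - \<tau>\<bar> * exp (\<mu> * s))"
      by (simp add: c_def mult_exp_exp[symmetric] algebra_simps)
         (simp add: mult_exp_exp algebra_simps)
    finally show ?thesis .
  qed
  have H_DERIV: "(H has_real_derivative (s - \<tau>) * exp (\<mu> * s)) (at s)" for s
    unfolding H_def[abs_def] using \<open>0 < \<mu>\<close>
    by (auto intro!: derivative_eq_intros simp: field_simps power2_eq_square)
  have H_cont: "continuous_on S H" for S
    unfolding H_def[abs_def] using \<open>0 < \<mu>\<close> by (auto intro!: continuous_intros)
  \<comment> \<open>The kernel \<open>\<bar>s - \<tau>\<bar> * exp (\<mu> * s)\<close> has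
    antiderivative \<open>- H\<close> to the left of \<tau> and \<open>H\<close> to the right, hence
    the split at \<tau>.\<close>
  have "g \<tau> - g 0 \<le> - c * H \<tau> - (- c * H 0)"
  proof (rule DERIV_le_imp_diff_le[OF \<tau>(1)])
    fix s assume s: "0 < s" "s < \<tau>"
    show "\<exists>f' g'. (g has_real_derivative f') (at s) \<and> ((\<lambda>s. - c * H s) has_real_derivative g') (at s) \<and> f' \<le> g'"
      using g_DERIV[of s] DERIV_cmult[OF H_DERIV, of "- c"] g'_le[of s] s \<tau>
      by (intro exI conjI) (assumption | simp add: algebra_simps)+
  qed (use \<tau> in \<open>auto intro!: continuous_intros g_cont H_cont\<close>)
  moreover have "g t - g \<tau> \<le> c * H t - c * H \<tau>"
  proof (rule DERIV_le_imp_diff_le[OF \<tau>(2)])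
    fix s assume s: "\<tau> < s" "s < t"
    show "\<exists>f' g'. (g has_real_derivative f') (at s) \<and> ((\<lambda>s. c * H s) has_real_derivative g') (at s) \<and> f' \<le> g'"
      using g_DERIV[of s] DERIV_cmult[OF H_DERIV, of "c"] g'_le[of s] s \<tau>
      by (intro exI conjI) (assumption | simp add: algebra_simps)+
  qed (use \<tau> in \<open>auto intro!: continuous_intros g_cont H_cont\<close>)
  moreover have "g t = N (x t)"
    using mat_exp_0[of "B \<tau>"] by (simp add: g_def E_def \<phi>)
  moreover have "g 0 \<le> K * exp (- \<omega> * t) * N (x 0)"
  proof -
    have "g 0 \<le> op_norm N (E 0) * N (x 0)"
      unfolding g_def using \<phi>(2) op_norm(1)[OF N] by (rule order_trans)
    also have "\<dots> \<le> K * exp (- \<omega> * t) * N (x 0)"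
      unfolding E_def using stab[of \<tau> t] \<tau> \<open>0 < t\<close>
      by (intro mult_right_mono is_normD(1)[OF N]) auto
    finally show ?thesis .
  qed
  ultimately have bound: "N (x t) \<le> K * exp (- \<omega> * t) * N (x 0) + c * (H t + H 0 - 2 * H \<tau>)"
    by (simp add: algebra_simps)
  have exp_split: "exp (- \<omega> * t) = exp ((\<mu> - \<omega>) * t) * exp (- \<mu> * t)"
    by (simp add: mult_exp_exp algebra_simps)
  note bound
  also have "c * (H t + H 0 - 2 * H \<tau>)
      = K * a * m * exp ((\<mu> - \<omega>) * t) * (exp (- \<mu> * t) * (H t + H 0 - 2 * H \<tau>))"
    unfolding c_def exp_split by (simp only: mult_ac)
  also have "\<dots> \<le> K * a * m * exp ((\<mu> - \<omega>) * t) * (ln 2 / \<mu>\<^sup>2)"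
    unfolding H_def \<tau>_def using assms by (intro mult_left_mono median_kernel_bound) auto
  finally show ?thesis by (simp add: algebra_simps)
qed

text \<open>The estimate is applied at a maximum point \<open>t\<close> of the weighted norm
  \<open>f\<close> on the compact interval, with \<open>m = f t\<close>. Then \<open>f t\<close>
  appears on both sides, with a factor \<theta> < 1 on the right, and is absorbed; the resulting
  constant does not depend on \<open>T\<close>.\<close>

lemma slowly_varying_decay:
  fixes x :: "real \<Rightarrow> real^'n" and B :: "real \<Rightarrow> real^'n^'n"
  assumes N: "is_norm N" and "0 \<le> T" "0 < \<mu>" "0 \<le> K" "0 \<le> a" and small: "K * a * ln 2 < \<mu>\<^sup>2"
    and x: "\<And>s. s \<in> {0..T} \<Longrightarrow> (x has_vector_derivative B s *v x s) (at s within {0..T})"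
    and B: "\<And>r s. r \<in> {0..T} \<Longrightarrow> s \<in> {0..T} \<Longrightarrow> op_norm N (B s - B r) \<le> a * \<bar>s - r\<bar>"
    and stab: "\<And>r s. r \<in> {0..T} \<Longrightarrow> s > 0 \<Longrightarrow>
      op_norm N (mat_exp (s *\<^sub>R B r)) \<le> K * exp (- \<omega> * s)"
  shows "N (x T) \<le> (K + 1) / (1 - K * a * ln 2 / \<mu>\<^sup>2) * exp (- (\<omega> - \<mu>) * T) * N (x 0)"
proof -
  define \<theta> where "\<theta> = K * a * ln 2 / \<mu>\<^sup>2"
  define f where "f s = N (x s) * exp ((\<omega> - \<mu>) * s)" for s
  have \<theta>: "0 \<le> \<theta>" "\<theta> < 1" using assms by (simp_all add: \<theta>_def)
  have x_cont: "continuous_on {0..T} x"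
    by (rule continuous_on_vector_derivative[OF x])
  have "continuous_on {0..T} f"
    unfolding f_def[abs_def]
    by (intro continuous_intros continuous_on_compose2[OF is_norm_continuous_on[OF N, of UNIV] x_cont]) auto
  then obtain t where t: "t \<in> {0..T}" "\<And>s. s \<in> {0..T} \<Longrightarrow> f s \<le> f t"
    using continuous_attains_sup[of "{0..T}" f] \<open>0 \<le> T\<close> by auto
  have N_eq: "N (x s) = f s * exp ((\<mu> - \<omega>) * s)" for s
    by (simp add: f_def mult.assoc mult_exp_exp algebra_simps)
  have f_nonneg: "0 \<le> f s" for s by (simp add: f_def is_normD(1)[OF N])
  \<comment> \<open>\<open>K + 1\<close> rather than \<open>K\<close> also covers a maximum at time
    0, where \<open>f t = N (x 0)\<close> and \<open>K\<close> may be below 1.\<close>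
  have "f t \<le> (K + 1) * N (x 0) + \<theta> * f t"
  proof (cases "t = 0")
    case True
    then show ?thesis using \<theta> is_normD(1)[OF N, of "x 0"] \<open>0 \<le> K\<close> by (simp add: f_def algebra_simps)
  next
    case False
    then have "0 < t" using t by simp
    have sub: "{0..t} \<subseteq> {0..T}" using t by auto
    have "N (x t) \<le> K * exp (- \<omega> * t) * N (x 0) + K * a * ln 2 / \<mu>\<^sup>2 * f t * exp ((\<mu> - \<omega>) * t)"
    proof (rule slowly_varying_estimate[OF N \<open>0 < t\<close>])
      show "N (x s) \<le> f t * exp ((\<mu> - \<omega>) * s)" if "s \<in> {0..t}" for s
        unfolding N_eq using that sub t by (intro mult_right_mono) auto
      show "(x has_vector_derivative B s *v x s) (at s within {0..t})" if "s \<in> {0..t}" for s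
        using has_vector_derivative_within_subset[OF x sub] that sub by blast
    qed (use assms sub f_nonneg in auto)
    then have "N (x t) * exp ((\<omega> - \<mu>) * t)
        \<le> (K * exp (- \<omega> * t) * N (x 0) + \<theta> * f t * exp ((\<mu> - \<omega>) * t)) * exp ((\<omega> - \<mu>) * t)"
      unfolding \<theta>_def by (intro mult_right_mono) auto
    then have "f t \<le> K * N (x 0) * exp (- \<mu> * t) + \<theta> * f t"
      unfolding f_def by (simp add: algebra_simps mult_exp_exp)
    also have "K * N (x 0) * exp (- \<mu> * t) \<le> K * N (x 0) * 1"
      using assms t by (intro mult_left_mono mult_nonneg_nonneg is_normD(1)[OF N]) auto
    finally show ?thesis using is_normD(1)[OF N, of "x 0"] by (simp add: algebra_simps)
  qed
  then have "f t \<le> (K + 1) / (1 - \<theta>) * N (x 0)"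
    using \<theta> by (simp add: field_simps)
  then have "f T \<le> (K + 1) / (1 - \<theta>) * N (x 0)"
    using t(2)[of T] \<open>0 \<le> T\<close> by simp
  then have "f T * exp ((\<mu> - \<omega>) * T) \<le> (K + 1) / (1 - \<theta>) * N (x 0) * exp ((\<mu> - \<omega>) * T)"
    by (rule mult_right_mono) simp
  then show ?thesis unfolding N_eq[of T] \<theta>_def by (simp add: ac_simps)
qed

subsection \<open>Global solutions\<close>

lemma integral_has_vector_derivative_atLeast:
  fixes f :: "real \<Rightarrow> 'a::banach"
  assumes "continuous_on {a..} f" "a \<le> t"
  shows "((\<lambda>u. integral {a..u} f) has_vector_derivative f t) (at t within {a..})"
proof -
  have "((\<lambda>u. integral {a..u} f) has_vector_derivative f t) (at t within {a..t + 1})"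
    using assms by (intro integral_has_vector_derivative continuous_on_subset[OF assms(1)]) auto
  moreover have "at t within {a..t + 1} = at t within {a..}"
    by (rule at_within_nhd[of _ "{..<t + 1}"]) auto
  ultimately show ?thesis by simp
qed

text \<open>Picard iteration for the rescaled solution \<open>exp (- 2 * C * t) *\<^sub>R x t\<close>: in the sup norm on
  \<open>[0, \<infinity>)\<close> the weight makes the iteration a contraction with factor \<open>1/2\<close>.\<close>

lemma lipschitz_imp_global_solution:
  fixes F :: "'a::banach \<Rightarrow> 'a"
  assumes "C > 0" and F: "\<And>x y. norm (F x - F y) \<le> C * norm (x - y)"
  obtains x where "x 0 = x0" "\<And>t. t \<ge> 0 \<Longrightarrow> (x has_vector_derivative F (x t)) (at t within {0..})"
proof -
  have F_cont: "continuous_on S F" for S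
  proof (rule lipschitz_on_continuous_on)
    show "C-lipschitz_on S F"
      using assms by (intro lipschitz_onI) (auto simp: dist_norm)
  qed
  define G where "G g s = F (exp (2 * C * s) *\<^sub>R apply_bcontfun g s)" for g and s :: real
  \<comment> \<open>Bounded continuous functions live on the whole line, so negative times are
    clamped to 0. \<open>G\<close> undoes the weight before applying \<open>F\<close>.\<close>
  define P where "P g t = exp (- (2 * C * max 0 t)) *\<^sub>R (x0 + integral {0..max 0 t} (G g))" for g and t :: real
  have G_cont: "continuous_on S (G g)" for S g
    unfolding G_def[abs_def]
    by (intro continuous_on_compose2[OF F_cont[of UNIV]] continuous_intros continuous_on_apply_bcontfun) auto
  have exp_int: "((\<lambda>s. b * exp (2 * C * s)) has_integral b / (2 * C) * (exp (2 * C * t) - 1)) {0..t}"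
    if "t \<ge> 0" for b t :: real
  proof -
    have "((\<lambda>s. b * exp (2 * C * s)) has_integral
        b / (2 * C) * exp (2 * C * t) - b / (2 * C) * exp (2 * C * 0)) {0..t}"
      using \<open>C > 0\<close>
      by (intro fundamental_theorem_of_calculus that)
         (auto intro!: derivative_eq_intros simp flip: has_real_derivative_iff_has_vector_derivative)
    then show ?thesis by (simp add: algebra_simps)
  qed
  \<comment> \<open>The gain from the weight. It is used with
    \<open>b = norm (F 0) + C * norm g\<close> to keep the iterates bounded, and with
    \<open>b = C * dist g h\<close> to get the factor 1/2.\<close>
  have int_le: "exp (- (2 * C * t)) * norm (integral {0..t} f) \<le> b / (2 * C)"
    if "t \<ge> 0" "b \<ge> 0" "continuous_on {0..t} f" "\<And>s. s \<in> {0..t} \<Longrightarrow> norm (f s) \<le> b * exp (2 * C * s)"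
    for t b and f :: "real \<Rightarrow> 'a"
  proof -
    have "norm (integral {0..t} f) \<le> integral {0..t} (\<lambda>s. b * exp (2 * C * s))"
      using that by (intro integral_norm_bound_integral integrable_continuous_real continuous_intros) auto
    also have "\<dots> = b / (2 * C) * (exp (2 * C * t) - 1)"
      using exp_int[OF that(1)] by (rule integral_unique)
    also have "\<dots> \<le> b / (2 * C) * exp (2 * C * t)"
      using that \<open>C > 0\<close> by (intro mult_left_mono) auto
    finally have "exp (- (2 * C * t)) * norm (integral {0..t} f)
        \<le> exp (- (2 * C * t)) * (b / (2 * C) * exp (2 * C * t))"
      by (rule mult_left_mono) simp
    also have "\<dots> = b / (2 * C)" by (simp add: exp_minus)
    finally show ?thesis .
  qed
  have P_bcontfun: "P g \<in> bcontfun" for g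
  proof (rule bcontfun_normI)
    have "continuous_on {0..} (\<lambda>u. integral {0..u} (G g))"
      using integral_has_vector_derivative_atLeast[OF G_cont, of 0]
      by (auto simp: continuous_on_eq_continuous_within intro: has_vector_derivative_continuous)
    then have "continuous_on UNIV (\<lambda>t. integral {0..max 0 t} (G g))"
      by (rule continuous_on_compose2) (auto intro!: continuous_intros)
    then show "continuous_on UNIV (P g)"
      unfolding P_def[abs_def] by (intro continuous_intros)
  next
    fix t :: real
    let ?t = "max 0 t"
    have G_le: "norm (G g s) \<le> (norm (F 0) + C * norm g) * exp (2 * C * s)" if "s \<in> {0..?t}" for s
    proof -
      have "norm (G g s) \<le> norm (F 0) + norm (G g s - F 0)"
        by (metis add.commute diff_add_cancel norm_triangle_ineq)
      also have "\<dots> \<le> norm (F 0) * exp (2 * C * s) + C * (exp (2 * C * s) * norm g)"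
      proof (rule add_mono)
        show "norm (F 0) \<le> norm (F 0) * exp (2 * C * s)"
          using that \<open>C > 0\<close> by (simp add: mult_le_cancel_left1)
        have "norm (G g s - F 0) \<le> C * (exp (2 * C * s) * norm (apply_bcontfun g s))"
          unfolding G_def using F[of "exp (2 * C * s) *\<^sub>R apply_bcontfun g s" 0] by simp
        also have "\<dots> \<le> C * (exp (2 * C * s) * norm g)"
          using \<open>C > 0\<close> by (intro mult_left_mono norm_bounded) auto
        finally show "norm (G g s - F 0) \<le> C * (exp (2 * C * s) * norm g)" .
      qed
      finally show ?thesis by (simp add: algebra_simps)
    qed
    have "norm (P g t) \<le> exp (- (2 * C * ?t)) * (norm x0 + norm (integral {0..?t} (G g)))"
      unfolding P_def by (simp add: norm_triangle_ineq)
    also have "\<dots> \<le> 1 * norm x0 + exp (- (2 * C * ?t)) * norm (integral {0..?t} (G g))"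
      unfolding distrib_left using \<open>C > 0\<close> by (intro add_mono mult_right_mono) auto
    also have "\<dots> \<le> 1 * norm x0 + (norm (F 0) + C * norm g) / (2 * C)"
      using \<open>C > 0\<close> by (intro add_left_mono int_le G_cont G_le) auto
    finally show "norm (P g t) \<le> 1 * norm x0 + (norm (F 0) + C * norm g) / (2 * C)" .
  qed
  have contraction: "dist (Bcontfun (P g)) (Bcontfun (P h)) \<le> 1 / 2 * dist g h" for g h
  proof (rule dist_bound)
    fix t :: real
    let ?t = "max 0 t"
    have G_le: "norm (G g s - G h s) \<le> C * dist g h * exp (2 * C * s)" for s :: real
    proof -
      have "norm (G g s - G h s)
          \<le> C * norm (exp (2 * C * s) *\<^sub>R apply_bcontfun g s - exp (2 * C * s) *\<^sub>R apply_bcontfun h s)"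
        unfolding G_def by (rule F)
      also have "\<dots> = C * (exp (2 * C * s) * dist (apply_bcontfun g s) (apply_bcontfun h s))"
        by (simp add: dist_norm flip: scaleR_diff_right)
      also have "\<dots> \<le> C * (exp (2 * C * s) * dist g h)"
        using \<open>C > 0\<close> by (intro mult_left_mono dist_bounded) auto
      finally show ?thesis by (simp add: ac_simps)
    qed
    have "P g t - P h t = exp (- (2 * C * ?t)) *\<^sub>R integral {0..?t} (\<lambda>s. G g s - G h s)"
      unfolding P_def
      by (simp add: integral_diff integrable_continuous_real G_cont algebra_simps)
    then have "dist (P g t) (P h t)
        = exp (- (2 * C * ?t)) * norm (integral {0..?t} (\<lambda>s. G g s - G h s))"
      by (simp add: dist_norm)
    also have "\<dots> \<le> C * dist g h / (2 * C)"
      using \<open>C > 0\<close> by (intro int_le G_le continuous_intros G_cont) auto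
    finally show "dist (apply_bcontfun (Bcontfun (P g)) t) (apply_bcontfun (Bcontfun (P h)) t) \<le> 1 / 2 * dist g h"
      using \<open>C > 0\<close> by (simp add: Bcontfun_inverse P_bcontfun)
  qed
  obtain g where "Bcontfun (P g) = g"
    using banach_fix_type[of "1/2" "\<lambda>g. Bcontfun (P g)"] contraction by auto
  then have g: "apply_bcontfun g = P g"
    by (metis Bcontfun_inverse P_bcontfun)
  define x where "x t = exp (2 * C * t) *\<^sub>R apply_bcontfun g t" for t
  have x_eq: "x t = x0 + integral {0..t} (G g)" if "t \<ge> 0" for t
    unfolding x_def g using that by (simp add: P_def exp_minus)
  show thesis
  proof
    show "x 0 = x0" by (simp add: x_eq)
    fix t :: real assume "t \<ge> 0"
    have "((\<lambda>t. x0 + integral {0..t} (G g)) has_vector_derivative G g t) (at t within {0..})"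
      using has_vector_derivative_add[OF has_vector_derivative_const
          integral_has_vector_derivative_atLeast[OF G_cont \<open>t \<ge> 0\<close>]] by simp
    then have "(x has_vector_derivative G g t) (at t within {0..})"
      by (rule has_vector_derivative_transform[rotated 2]) (use \<open>t \<ge> 0\<close> x_eq in auto)
    then show "(x has_vector_derivative F (x t)) (at t within {0..})"
      by (simp add: G_def x_def)
  qed
qed

text \<open>The field is Lipschitz only on balls, so it is composed with the projection onto a ball
  around \<open>X\<close>, which makes it globally Lipschitz. Invariance keeps the resulting curve
  inside the ball, where both fields agree.\<close>

lemma invariant_set_imp_global_sdc_solution:
  fixes A :: "real ^ 'n \<Rightarrow> real ^ 'n ^ 'n"
  assumes lip: "\<And>R. \<exists>C. \<forall>x\<in>cball 0 R. \<forall>y\<in>cball 0 R. norm (A x *v x - A y *v y) \<le> C * norm (x - y)"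
    and "bounded X" "x0 \<in> X"
    and inv: "\<And>J \<xi> t. sdc_solution A J \<xi> \<Longrightarrow> \<xi> 0 \<in> X \<Longrightarrow> t \<in> J \<Longrightarrow> 0 \<le> t \<Longrightarrow> \<xi> t \<in> X"
  obtains \<xi> where "sdc_solution A {0..} \<xi>" "\<xi> 0 = x0"
proof -
  \<comment> \<open>The strict inequality matters: no point of \<open>X\<close> lies on the sphere
    of radius \<open>R\<close>.\<close>
  obtain R where R: "R > 0" "\<And>x. x \<in> X \<Longrightarrow> norm x < R"
    using \<open>bounded X\<close> bounded_pos_less by blast
  define p :: "real^'n \<Rightarrow> real^'n" where "p = closest_point (cball 0 R)"
  have ne: "cball (0::real^'n) R \<noteq> {}" using R by simp
  have p: "p x \<in> cball 0 R" for x
    unfolding p_def using closest_point_in_set[OF closed_cball ne] .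
  have p_eq: "p x = x" if "norm x \<le> R" for x
    unfolding p_def using that by (intro closest_point_self) simp
  obtain C where C: "\<And>x y. x \<in> cball 0 R \<Longrightarrow> y \<in> cball 0 R \<Longrightarrow>
      norm (A x *v x - A y *v y) \<le> C * norm (x - y)"
    using lip[of R] by blast
  \<comment> \<open>The projection is nonexpansive; \<open>\<bar>C\<bar> + 1\<close> supplies the
    positive constant that the global existence result asks for.\<close>
  have p_lip: "norm (A (p x) *v p x - A (p y) *v p y) \<le> (\<bar>C\<bar> + 1) * norm (x - y)" for x y
  proof -
    have "norm (A (p x) *v p x - A (p y) *v p y) \<le> C * norm (p x - p y)"
      by (intro C p)
    also have "\<dots> \<le> (\<bar>C\<bar> + 1) * norm (x - y)"
      using closest_point_lipschitz[OF convex_cball closed_cball ne, of x y]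
      by (intro mult_mono) (auto simp: dist_norm p_def)
    finally show ?thesis .
  qed
  obtain \<xi> where \<xi>: "\<xi> 0 = x0"
    "\<And>t. t \<ge> 0 \<Longrightarrow> (\<xi> has_vector_derivative A (p (\<xi> t)) *v p (\<xi> t)) (at t within {0..})"
    by (rule lipschitz_imp_global_solution[OF _ p_lip, of x0]) auto
  have sol: "sdc_solution A J \<xi>"
    if "is_interval J" "0 \<in> J" "J \<subseteq> {0..}" "\<And>t. t \<in> J \<Longrightarrow> norm (\<xi> t) \<le> R" for J
    unfolding sdc_solution_def
  proof (intro conjI that ballI)
    fix t assume "t \<in> J"
    then show "(\<xi> has_vector_derivative A (\<xi> t) *v \<xi> t) (at t within J)"
      using has_vector_derivative_within_subset[OF \<xi>(2) that(3), of t] that p_eq by auto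
  qed
  have \<xi>_cont: "continuous_on {0..} \<xi>"
    by (rule continuous_on_vector_derivative[OF \<xi>(2)]) simp
  have cont: "continuous_on {0..u} (\<lambda>t. norm (\<xi> t))" for u
    by (intro continuous_on_norm continuous_on_subset[OF \<xi>_cont]) auto
  have "norm (\<xi> 0) < R" using \<xi>(1) R \<open>x0 \<in> X\<close> by simp
  have "norm (\<xi> u) < R" if u: "u \<ge> 0" for u
  proof (rule ccontr)
    assume "\<not> norm (\<xi> u) < R"
    \<comment> \<open>The least element \<open>T\<close> of \<open>S\<close> is the first time on
      the sphere. Up to \<open>T\<close> the curve solves the original system, so invariance puts
      \<open>\<xi> T\<close> in \<open>X\<close>, strictly inside the ball: a contradiction.\<close>
    define S where "S = {t \<in> {0..u}. norm (\<xi> t) = R}"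
    have hit: "\<exists>s\<in>S. s \<le> t" if "t \<in> {0..u}" "norm (\<xi> t) \<ge> R" for t
    proof -
      have "\<exists>s\<ge>0. s \<le> t \<and> norm (\<xi> s) = R"
        by (rule IVT'[OF _ _ _ cont]) (use that \<open>norm (\<xi> 0) < R\<close> in simp_all)
      then obtain s where "0 \<le> s" "s \<le> t" "norm (\<xi> s) = R" by blast
      then have "s \<in> S" using that(1) by (simp add: S_def)
      then show ?thesis using \<open>s \<le> t\<close> by blast
    qed
    have "closed S"
      unfolding S_def using continuous_closed_preimage_constant[OF cont closed_atLeastAtMost] .
    moreover have "bounded S"
      by (rule bounded_subset[OF bounded_closed_interval[of 0 u]]) (auto simp: S_def)
    ultimately have "compact S" by (simp add: compact_eq_bounded_closed)
    moreover obtain s where "s \<in> S" using hit[of u] u \<open>\<not> norm (\<xi> u) < R\<close> by auto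
    ultimately obtain T where T: "T \<in> S" "\<And>t. t \<in> S \<Longrightarrow> T \<le> t"
      using compact_attains_inf[of S] by blast
    have T_in: "T \<in> {0..u}" "norm (\<xi> T) = R" using T(1) by (simp_all add: S_def)
    have "norm (\<xi> t) \<le> R" if "t \<in> {0..T}" for t
    proof (rule ccontr)
      assume "\<not> norm (\<xi> t) \<le> R"
      moreover have "t \<in> {0..u}" using that T_in(1) by simp
      ultimately obtain s where "s \<in> S" "s \<le> t"
        using hit[of t] by auto
      then have "t = T" using T(2)[of s] that by simp
      then show False using T_in(2) \<open>\<not> norm (\<xi> t) \<le> R\<close> by simp
    qed
    then have "sdc_solution A {0..T} \<xi>"
      using T_in(1) by (intro sol) (simp_all add: is_interval_cc)
    then have "\<xi> T \<in> X"
      by (rule inv) (use T_in(1) \<xi>(1) \<open>x0 \<in> X\<close> in simp_all)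
    then show False using R(2)[of "\<xi> T"] T_in(2) by simp
  qed
  then have "sdc_solution A {0..} \<xi>"
    by (intro sol) (auto simp: is_interval_ci less_imp_le)
  then show thesis using \<xi>(1) that by blast
qed

subsection \<open>State-dependent coefficient systems\<close>

text \<open>A product of Lipschitz maps is Lipschitz where both factors are bounded, here on balls;
  \<open>b\<close> and \<open>c\<close> translate between \<open>N\<close> and the Euclidean
  norm.\<close>

lemma lipschitz_sdc_field:
  assumes N: "is_norm N" and lip: "\<forall>x y. op_norm N (A x - A y) \<le> C * N (x - y)"
  shows "\<exists>D. \<forall>x\<in>cball 0 R. \<forall>y\<in>cball 0 R. norm (A x *v x - A y *v y) \<le> D * norm (x - y)"
proof -
  obtain c b where cb: "c > 0" "b > 0" "\<And>x. c * norm x \<le> N x" "\<And>x. N x \<le> b * norm x"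
    using is_norm_equivalent[OF N] by blast
  have lip': "op_norm N (A x - A y) \<le> \<bar>C\<bar> * N (x - y)" for x y
    by (rule order_trans[OF lip[rule_format] mult_right_mono[OF abs_ge_self is_normD(1)[OF N]]])
  define D where "D = 2 * (\<bar>C\<bar> * (b * R)) + op_norm N (A 0)"
  have bound: "norm (A x *v x - A y *v y) \<le> D * b / c * norm (x - y)"
    if "x \<in> cball 0 R" "y \<in> cball 0 R" for x y
  proof -
    have R: "norm x \<le> R" "norm y \<le> R" using that by auto
    from order_trans[OF norm_ge_zero R(1)] have "0 \<le> R" .
    have NR: "N z \<le> b * R" if "norm z \<le> R" for z
      using cb(4)[of z] mult_left_mono[OF that, of b] cb(2) by linarith
    have "D \<ge> 0" using \<open>0 \<le> R\<close> cb op_norm(2)[OF N] by (simp add: D_def)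
    \<comment> \<open>Splitting off \<open>A 0\<close> leaves differences controlled by the
      Lipschitz bound on the ball; the three summands give the three parts of
      \<open>D\<close>.\<close>
    have "A x *v x - A y *v y = (A x - A y) *v x + ((A y - A 0) *v (x - y) + A 0 *v (x - y))"
      by (simp add: algebra_simps)
    then have "N (A x *v x - A y *v y)
        \<le> N ((A x - A y) *v x) + (N ((A y - A 0) *v (x - y)) + N (A 0 *v (x - y)))"
      using is_normD(4)[OF N, of "(A x - A y) *v x" "(A y - A 0) *v (x - y) + A 0 *v (x - y)"]
        is_normD(4)[OF N, of "(A y - A 0) *v (x - y)" "A 0 *v (x - y)"] by simp
    also have "\<dots> \<le> \<bar>C\<bar> * N (x - y) * (b * R)
        + (\<bar>C\<bar> * (b * R) * N (x - y) + op_norm N (A 0) * N (x - y))"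
    proof (intro add_mono op_norm(1)[OF N])
      have "N ((A x - A y) *v x) \<le> op_norm N (A x - A y) * N x" by (rule op_norm(1)[OF N])
      also have "\<dots> \<le> \<bar>C\<bar> * N (x - y) * (b * R)"
        by (intro mult_mono lip' NR R mult_nonneg_nonneg is_normD(1)[OF N] abs_ge_zero)
      finally show "N ((A x - A y) *v x) \<le> \<bar>C\<bar> * N (x - y) * (b * R)" .
      have "op_norm N (A y - A 0) \<le> \<bar>C\<bar> * (b * R)"
        using lip'[of y 0] mult_left_mono[OF NR[OF R(2)], of "\<bar>C\<bar>"] by simp
      from order_trans[OF op_norm(1)[OF N] mult_right_mono[OF this is_normD(1)[OF N]]]
      show "N ((A y - A 0) *v (x - y)) \<le> \<bar>C\<bar> * (b * R) * N (x - y)" .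
    qed
    also have "\<dots> = D * N (x - y)" by (simp add: D_def algebra_simps)
    also have "\<dots> \<le> D * (b * norm (x - y))" using \<open>D \<ge> 0\<close> cb(4) by (intro mult_left_mono)
    finally have "N (A x *v x - A y *v y) \<le> D * (b * norm (x - y))" .
    from order_trans[OF cb(3) this] have "c * norm (A x *v x - A y *v y) \<le> D * (b * norm (x - y))" .
    then show ?thesis using cb(1) by (simp add: pos_le_divide_eq ac_simps)
  qed
  show ?thesis using bound by blast
qed

theorem corollary2p8:
  fixes N :: "real ^ 'n \<Rightarrow> real"
    and A :: "real ^ 'n \<Rightarrow> real ^ 'n ^ 'n"
    and X :: "(real ^ 'n) set"
    and L K \<omega> M :: real
  assumes "is_norm N"
    and "\<exists>C. \<forall>x y. op_norm N (A x - A y) \<le> C * N (x - y)"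
    and "bounded X"
    and "\<And>J \<xi> t. sdc_solution A J \<xi> \<Longrightarrow> \<xi> 0 \<in> X \<Longrightarrow> t \<in> J \<Longrightarrow> 0 \<le> t \<Longrightarrow> \<xi> t \<in> X"
    and "K > 0" and "\<omega> > 0"
    and "\<And>x1 x2. x1 \<in> X \<Longrightarrow> x2 \<in> X \<Longrightarrow> op_norm N (A x1 - A x2) \<le> L * N (x1 - x2)"
    and "\<And>x s. x \<in> X \<Longrightarrow> s > 0 \<Longrightarrow> op_norm N (mat_exp (s *\<^sub>R A x)) \<le> K * exp (- \<omega> * s)"
    and "M = (SUP x\<in>X. N (A x *v x))"
    and "K * L * M * ln 2 < \<omega>\<^sup>2"
  shows "uniformly_exponentially_stable_on N A X"
proof (cases "X = {}")
  \<comment> \<open>An empty supremum says nothing about the sign of \<open>M\<close>, but the claim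
    is vacuous here.\<close>
  case True
  then show ?thesis
    unfolding uniformly_exponentially_stable_on_def using zero_less_one by blast
next
  case False
  note N = assms(1) and inv = assms(4)
  obtain C where C: "\<forall>x y. op_norm N (A x - A y) \<le> C * N (x - y)"
    using assms(2) by blast
  note field_lip = lipschitz_sdc_field[OF N C]
  \<comment> \<open>The supremum is over a bounded set: the field vanishes at 0 and is Lipschitz on
    a ball containing \<open>X\<close>.\<close>
  have M_ub: "N (A x *v x) \<le> M" if "x \<in> X" for x
  proof -
    obtain b where b: "b > 0" "\<And>x. N x \<le> b * norm x"
      using is_norm_equivalent[OF N] by metis
    obtain R where R: "R > 0" "\<And>x. x \<in> X \<Longrightarrow> norm x \<le> R"
      using assms(3) unfolding bounded_pos by blast
    obtain D where D: "\<forall>x\<in>cball 0 R. \<forall>y\<in>cball 0 R. norm (A x *v x - A y *v y) \<le> D * norm (x - y)"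
      using field_lip by blast
    have "N (A y *v y) \<le> b * (\<bar>D\<bar> * R)" if "y \<in> X" for y
    proof -
      have "norm (A y *v y) \<le> D * norm y"
        using D[rule_format, of y 0] R(1) R(2)[OF that] by simp
      also have "\<dots> \<le> \<bar>D\<bar> * R" using R(2)[OF that] by (intro mult_mono) auto
      finally have "b * norm (A y *v y) \<le> b * (\<bar>D\<bar> * R)" using b(1) by (intro mult_left_mono) auto
      from order_trans[OF b(2) this] show ?thesis .
    qed
    then have "bdd_above ((\<lambda>y. N (A y *v y)) ` X)" by (rule bdd_aboveI2)
    from cSUP_upper[OF that this] show ?thesis unfolding assms(9) .
  qed
  obtain x1 where "x1 \<in> X" using False by blast
  from order_trans[OF is_normD(1)[OF N] M_ub[OF this]] have "0 \<le> M" .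
  \<comment> \<open>\<open>L\<close> may be negative, while the estimates need \<open>a\<close>
    nonnegative. In that case \<open>a = 0\<close>, and the smallness condition reduces to
    \<open>0 < \<omega>\<^sup>2\<close>.\<close>
  define L' where "L' = max L 0"
  define a where "a = L' * M"
  have "0 \<le> a" using \<open>0 \<le> M\<close> by (simp add: a_def L'_def)
  have L': "op_norm N (A x - A y) \<le> L' * N (x - y)" if "x \<in> X" "y \<in> X" for x y
    using assms(7)[OF that] mult_right_mono[of L L' "N (x - y)"] is_normD(1)[OF N]
    by (simp add: L'_def)
  have small: "K * a * ln 2 < \<omega>\<^sup>2"
  proof (cases "L \<ge> 0")
    case True
    then show ?thesis using assms(10) by (simp add: a_def L'_def mult.assoc)
  qed (use assms(6) in \<open>simp add: a_def L'_def\<close>)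
  then have "sqrt (K * a * ln 2) < \<omega>"
    using real_sqrt_less_mono[of "K * a * ln 2" "\<omega>\<^sup>2"] assms(6) by simp
  \<comment> \<open>The strict hypothesis leaves a gap below \<omega>; the difference
    \<open>\<omega> - \<mu>\<close> becomes the decay rate.\<close>
  then obtain \<mu> where \<mu>: "sqrt (K * a * ln 2) < \<mu>" "\<mu> < \<omega>"
    using dense[of "sqrt (K * a * ln 2)" \<omega>] by blast
  have q: "0 \<le> K * a * ln 2" using \<open>0 \<le> a\<close> assms(5) by simp
  have "0 < \<mu>" using \<mu>(1) real_sqrt_ge_zero[OF q] by linarith
  have small_\<mu>: "K * a * ln 2 < \<mu>\<^sup>2"
    using power_strict_mono[OF \<mu>(1) real_sqrt_ge_zero[OF q], of 2] q by simp
  define K' where "K' = (K + 1) / (1 - K * a * ln 2 / \<mu>\<^sup>2)"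
  have "K' > 0" using small_\<mu> \<open>0 < \<mu>\<close> assms(5) by (simp add: K'_def)
  have decay: "N (\<xi> t) \<le> K' * exp (- (\<omega> - \<mu>) * t) * N (\<xi> 0)"
    if sol: "sdc_solution A J \<xi>" and "\<xi> 0 \<in> X" "t \<in> J" "0 \<le> t" for J \<xi> t
  proof -
    have "is_interval J" "0 \<in> J" using sol by (simp_all add: sdc_solution_def)
    then have sub: "{0..t} \<subseteq> J"
      using mem_is_interval_1_I[of J 0 t] \<open>t \<in> J\<close> by auto
    have deriv: "(\<xi> has_vector_derivative A (\<xi> s) *v \<xi> s) (at s within S)"
      if "s \<in> {0..t}" "S \<subseteq> {0..t}" for s S
    proof (rule has_vector_derivative_within_subset)
      show "(\<xi> has_vector_derivative A (\<xi> s) *v \<xi> s) (at s within J)"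
        using sol that(1) sub unfolding sdc_solution_def by blast
      show "S \<subseteq> J" using that(2) sub by (rule order_trans)
    qed
    have in_X: "\<xi> s \<in> X" if "s \<in> {0..t}" for s
      by (rule inv[OF sol \<open>\<xi> 0 \<in> X\<close>]) (use that sub in auto)
    \<comment> \<open>The trajectory stays in \<open>X\<close>, so its speed is at most
      \<open>M\<close>.\<close>
    have N_diff: "N (\<xi> s - \<xi> r) \<le> M * (s - r)" if "0 \<le> r" "r \<le> s" "s \<le> t" for r s
      by (rule is_norm_mvt[OF N \<open>r \<le> s\<close> deriv]; (rule M_ub[OF in_X])?) (use that in auto)
    have N_abs: "N (\<xi> s - \<xi> r) \<le> M * \<bar>s - r\<bar>" if "r \<in> {0..t}" "s \<in> {0..t}" for r s
    proof (cases "r \<le> s")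
      case False
      have "N (\<xi> s - \<xi> r) = N (\<xi> r - \<xi> s)"
        using is_normD(3)[OF N, of "- 1" "\<xi> r - \<xi> s"] by simp
      then show ?thesis using N_diff[of s r] that False by simp
    qed (use N_diff[of r s] that in simp)
    show ?thesis
      unfolding K'_def
    \<comment> \<open>Along the fixed trajectory the system is linear with coefficient
      \<open>B s = A (\<xi> s)\<close>, which is Lipschitz in time with constant
      \<open>a = L' * M\<close>.\<close>
    proof (rule slowly_varying_decay[OF N \<open>0 \<le> t\<close> \<open>0 < \<mu>\<close> _ \<open>0 \<le> a\<close> small_\<mu>])
      fix r s assume rs: "r \<in> {0..t}" "s \<in> {0..t}"
      have "op_norm N (A (\<xi> s) - A (\<xi> r)) \<le> L' * N (\<xi> s - \<xi> r)"
        by (intro L' in_X rs)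
      also have "\<dots> \<le> L' * (M * \<bar>s - r\<bar>)"
        by (intro mult_left_mono N_abs rs) (simp add: L'_def)
      finally show "op_norm N (A (\<xi> s) - A (\<xi> r)) \<le> a * \<bar>s - r\<bar>"
        by (simp add: a_def mult.assoc)
    next
      fix s assume "s \<in> {0..t}"
      then show "(\<xi> has_vector_derivative A (\<xi> s) *v \<xi> s) (at s within {0..t})"
        by (rule deriv) simp
    next
      fix r s :: real assume "r \<in> {0..t}" "s > 0"
      then show "op_norm N (mat_exp (s *\<^sub>R A (\<xi> r))) \<le> K * exp (- \<omega> * s)"
        by (intro assms(8) in_X)
    qed (use assms(5) in simp)
  qed
  show ?thesis
    unfolding uniformly_exponentially_stable_on_def
  proof (rule exI[of _ K'], rule conjI[OF \<open>K' > 0\<close>], rule exI[of _ "\<omega> - \<mu>"],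
      intro conjI ballI allI impI)
    show "\<omega> - \<mu> > 0" using \<mu>(2) by simp
  next
    fix x0 J \<xi> t
    assume "x0 \<in> X" "sdc_solution A J \<xi> \<and> \<xi> 0 = x0" "t \<in> J" "0 \<le> t"
    then show "N (\<xi> t) \<le> K' * exp (- (\<omega> - \<mu>) * t) * N x0"
      using decay[of J \<xi> t] by simp
  next
    fix x0 assume "x0 \<in> X"
    obtain \<xi> where "sdc_solution A {0..} \<xi>" "\<xi> 0 = x0"
      using invariant_set_imp_global_sdc_solution[of A, OF field_lip assms(3) \<open>x0 \<in> X\<close>] inv by blast
    then show "\<exists>\<xi>. sdc_solution A {0..} \<xi> \<and> \<xi> 0 = x0" by blast
  qed
qed

end
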